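(* Let $n\ge1$. The map $\varphi$ on $L(3,n)\setminus E_{3,n}$ agrees with the greedy algorithm $GA$ (applied for every rank $i$ to $L_i(3,n)$ and $L_{i+1}(3,n)$): (1) for $\lambda\in L(3,n)$, $GA(\lambda)$ is well defined (exists) if and only if $\lambda\notin E_{3,n}$; (2) if $\lambda\notin E_{3,n}$, then $\varphi(\lambda)=GA(\lambda)$.
   Context: $\mathbb{N}=\{0,1,2,\dots\}$. $L(3,n)$ is the poset of integer triples $\lambda=(\lambda_1,\lambda_2,\lambda_3)$ with $n\ge\lambda_1\ge\lambda_2\ge\lambda_3\ge 0$, ordered componentwise, ranked by $|\lambda|=\lambda_1+\lambda_2+\lambda_3$; $L_i(3,n)$ is the set of elements of rank $i$. The dual of $\lambda$ in $L(3,n)$ is $\lambda^*=(n-\lambda_3,n-\lambda_2,n-\lambda_1)$. For every integer $n\ge0$, $$S_{3,n}=\{(4k+\ell,2k,0): k\in\mathbb{N},\ \ell\in\mathbb{N}\setminus\{1\},\ 4k+\ell\le n,\ 6k+\ell\le 3n/2\},\qquad E_{3,n}=\{\lambda^*:\lambda\in S_{3,n}\}$$ (dual in $L(3,n)$). A triple that is not a partition belongs to no $E_{3,p}$. The map $\varphi$ is defined on $\lambda\in L(3,n)\setminus E_{3,n}$ by: if $\lambda\in E_{3,\lambda_1}$ then $\varphi(\lambda)=(\lambda_1+1,\lambda_2,\lambda_3)$; otherwise, $\varphi(\lambda)=(\lambda_1,\lambda_2+1,\lambda_3)$ if $\lambda_2+\lambda_3$ is even and $(\lambda_1-1,\lambda_2+1,\lambda_3)\notin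 E_{3,\lambda_1-1}$; $\varphi(\lambda)=(\lambda_1,\lambda_2+1,\lambda_3)$ if $\lambda_2+\lambda_3$ is odd and $(\lambda_1-1,\lambda_2,\lambda_3+1)\in E_{3,\lambda_1-1}$; $\varphi(\lambda)=(\lambda_1,\lambda_2,\lambda_3+1)$ if $\lambda_2+\lambda_3$ is odd and $(\lambda_1-1,\lambda_2,\lambda_3+1)\notin E_{3,\lambda_1-1}$. (These cases cover all of $L(3,n)\setminus E_{3,n}$.) Greedy algorithm: order the elements of $L_i(3,n)$ and of $L_{i+1}(3,n)$ increasingly in lexicographic order (compare at the first differing entry; the larger entry gives the larger partition). List $L_i(3,n)$ as $\lambda^1<\cdots<\lambda^N$. For $j=1,\dots,N$ in turn, let $GA(\lambda^j)$ be the lexicographically smallest element of $L_{i+1}(3,n)$ that covers $\lambda^j$ in the componentwise order and is not already equal to $GA(\lambda^{j'})$ for some $j'<j$; if there is no such element, $GA(\lambda^j)$ does not exist (is not well defined). *)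

theory Defs
  imports Main "HOL-Library.Product_Lexorder"
begin

(* Product_Lexorder makes the order on triples lexicographic: this is the order meant by
   <, sorted_list_of_set and Min on triples below.  The partial order of the poset L(3,n)
   is the componentwise order comp_le. *)

type_synonym triple = "int \<times> int \<times> int"

definition L3 :: "int \<Rightarrow> triple set" where
  "L3 n = {(a, b, c). n \<ge> a \<and> a \<ge> b \<and> b \<ge> c \<and> c \<ge> 0}"

fun rank3 :: "triple \<Rightarrow> int" where
  "rank3 (a, b, c) = a + b + c"

definition L3_rank :: "int \<Rightarrow> int \<Rightarrow> triple set" where
  "L3_rank n i = {x \<in> L3 n. rank3 x = i}"

fun comp_le :: "triple \<Rightarrow> triple \<Rightarrow> bool" where
  "comp_le (a, b, c) (a', b', c') \<longleftrightarrow> a \<le> a' \<and> b \<le> b' \<and> c \<le> c'"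

definition comp_less :: "triple \<Rightarrow> triple \<Rightarrow> bool" where
  "comp_less x y \<longleftrightarrow> comp_le x y \<and> x \<noteq> y"

(* y covers x in the poset L(3,n). *)
definition covered_by :: "int \<Rightarrow> triple \<Rightarrow> triple \<Rightarrow> bool" where
  "covered_by n x y \<longleftrightarrow> x \<in> L3 n \<and> y \<in> L3 n \<and> comp_less x y \<and>
     \<not> (\<exists>z \<in> L3 n. comp_less x z \<and> comp_less z y)"

fun dual3 :: "int \<Rightarrow> triple \<Rightarrow> triple" where
  "dual3 n (a, b, c) = (n - c, n - b, n - a)"

(* The last condition is 6k + l \<le> 3n/2 with the denominator cleared. *)
definition S3 :: "int \<Rightarrow> triple set" where
  "S3 n = {(4 * k + l, 2 * k, 0) | k l.
     k \<ge> 0 \<and> l \<ge> 0 \<and> l \<noteq> 1 \<and> 4 * k + l \<le> n \<and> 2 * (6 * k + l) \<le> 3 * n}"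

(* Contains only elements of L(3,n); empty for n < 0. *)
definition E3 :: "int \<Rightarrow> triple set" where
  "E3 n = dual3 n ` S3 n"

(* The last None is the case not covered by the rules defining the map. *)
fun phi_rule :: "triple \<Rightarrow> triple option" where
  "phi_rule (a, b, c) =
     (if (a, b, c) \<in> E3 a then Some (a + 1, b, c)
      else if even (b + c) \<and> (a - 1, b + 1, c) \<notin> E3 (a - 1) then Some (a, b + 1, c)
      else if odd (b + c) \<and> (a - 1, b, c + 1) \<in> E3 (a - 1) then Some (a, b + 1, c)
      else if odd (b + c) \<and> (a - 1, b, c + 1) \<notin> E3 (a - 1) then Some (a, b, c + 1)
      else None)"

definition phi :: "int \<Rightarrow> triple \<Rightarrow> triple option" where
  "phi n x = (if x \<in> L3 n - E3 n then phi_rule x else None)"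

(* One step of the greedy algorithm; m records the assignments made so far. *)
definition greedy_step ::
  "int \<Rightarrow> int \<Rightarrow> triple \<Rightarrow> (triple \<Rightarrow> triple option) \<Rightarrow> (triple \<Rightarrow> triple option)" where
  "greedy_step n i x m =
     (let C = {y \<in> L3_rank n (i + 1). covered_by n x y \<and> y \<notin> ran m}
      in if C = {} then m else m(x \<mapsto> Min C))"

definition greedy :: "int \<Rightarrow> int \<Rightarrow> triple \<Rightarrow> triple option" where
  "greedy n i = fold (greedy_step n i) (sorted_list_of_set (L3_rank n i)) Map.empty"

(* None means that GA is not defined at x. *)
definition GA :: "int \<Rightarrow> triple \<Rightarrow> triple option" where
  "GA n x = greedy n (rank3 x) x"

end

theory Submission
  imports Defs
begin

text \<open>
  The greedy algorithm reproduces any injective partial matching into covers with one property: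
  if a cover \<open>y\<close> of \<open>x\<close> is smaller than the partner of \<open>x\<close>, or \<open>x\<close> has no partner, then \<open>y\<close>
  is the partner of some \<open>x' < x\<close> (\<open>greedy_eqI\<close>). When the algorithm reaches \<open>x\<close>, the covers
  below the partner of \<open>x\<close> are then occupied, and injectivity keeps the partner itself free.
  It remains to show that \<open>\<phi>\<close> is such a matching and that its domain is the complement of \<open>E3 n\<close>.

  Both are visible once the rules of \<open>\<phi>\<close> are written in terms of the slack
  \<open>s = 2b - a - c\<close> of a triple \<open>(a, b, c)\<close>. The slack is the parameter \<open>\<ell>\<close> in the definition of
  \<open>S3\<close>, so a partition \<open>(a, b, c)\<close> lies in \<open>E3 a\<close> exactly when \<open>a - b\<close> is even and \<open>s\<close> is nonnegative and
  different from 1. It turns out that \<open>s\<close> and the parities of \<open>a - b\<close> and \<open>b + c\<close> decide which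
  entry \<open>\<phi>\<close> raises. Raising the first, second or third entry changes \<open>s\<close> by \<open>-1\<close>, \<open>+2\<close> or \<open>-1\<close>,
  and \<open>s\<close> is even exactly when the parities of \<open>a - b\<close> and \<open>b + c\<close> agree.

  From the slack and the parities of a triple one reads off which entry \<open>\<phi>\<close> can have raised
  to reach it, and at most one entry qualifies (\<open>rules_exclusive\<close>). This gives injectivity.
  The covers of \<open>x\<close> increase lexicographically as the raised entry moves to the left.
  Hence a cover of \<open>x\<close> that raises entry \<open>i\<close> is the partner of a smaller triple if \<open>\<phi>\<close> reaches it
  by raising an entry to the left of \<open>i\<close>, and this happens for every cover that is smaller than
  \<open>\<phi> x\<close>, and for every cover if \<open>x\<close> is in \<open>E3 n\<close> (\<open>second_cover_taken\<close>, \<open>third_cover_taken\<close>).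
\<close>

section \<open>Matchings that the greedy algorithm reproduces\<close>

definition candidates :: "int \<Rightarrow> int \<Rightarrow> triple \<Rightarrow> triple set" where
  "candidates n i x = {y \<in> L3_rank n (i + 1). covered_by n x y}"

lemma finite_L3_rank: "finite (L3_rank n i)"
proof (rule finite_subset)
  show "L3_rank n i \<subseteq> {0..n} \<times> {0..n} \<times> {0..n}"
    by (auto simp: L3_rank_def L3_def)
qed simp

text \<open>
  The statement speaks of initial segments \<open>xs\<close> of \<open>L3_rank n i\<close> so that induction applies. After
  an initial segment has been processed, the occupied elements are the partners of its members,
  and the segment contains every \<open>x'\<close> that the third assumption provides for the next element.
\<close>

lemma fold_greedy_step_eq:
  fixes f :: "triple \<Rightarrow> triple option"
  assumes cand: "\<And>x y. x \<in> L3_rank n i \<Longrightarrow> f x = Some y \<Longrightarrow> y \<in> candidates n i x"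
    and inj: "\<And>x x' y. f x = Some y \<Longrightarrow> f x' = Some y \<Longrightarrow> x = x'"
    and taken: "\<And>x y. x \<in> L3_rank n i \<Longrightarrow> y \<in> candidates n i x \<Longrightarrow>
      (\<And>z. f x = Some z \<Longrightarrow> y < z) \<Longrightarrow> \<exists>x' \<in> L3_rank n i. x' < x \<and> f x' = Some y"
    and "sorted_wrt (<) xs" "set xs \<subseteq> L3_rank n i"
    and "\<And>x x'. x \<in> set xs \<Longrightarrow> x' \<in> L3_rank n i \<Longrightarrow> x' < x \<Longrightarrow> x' \<in> set xs"
  shows "fold (greedy_step n i) xs Map.empty = f |` set xs"
  using assms(4-6)
proof (induction xs rule: rev_induct)
  case Nil
  then show ?case by simp
next
  case (snoc x xs)
  have before: "x' < x" if "x' \<in> set xs" for x'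
    using snoc.prems(1) that by (simp add: sorted_wrt_append)
  have below: "x' \<in> set xs" if "x' \<in> L3_rank n i" "x' < x" for x'
    using snoc.prems(3)[of x x'] that by auto
  have x: "x \<in> L3_rank n i" "x \<notin> set xs"
    using snoc.prems(2) before[of x] by auto
  have "fold (greedy_step n i) xs Map.empty = f |` set xs"
  proof (rule snoc.IH)
    show "sorted_wrt (<) xs" "set xs \<subseteq> L3_rank n i"
      using snoc.prems by (auto simp: sorted_wrt_append)
    show "x'' \<in> set xs" if "x' \<in> set xs" "x'' \<in> L3_rank n i" "x'' < x'" for x' x''
      using below before that less_trans by blast
  qed
  moreover define C where "C = {y \<in> candidates n i x. y \<notin> ran (f |` set xs)}"
  moreover have "{y \<in> L3_rank n (i + 1). covered_by n x y \<and> y \<notin> ran (f |` set xs)} = C"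
    by (auto simp: C_def candidates_def)
  ultimately have step: "fold (greedy_step n i) (xs @ [x]) Map.empty =
      (if C = {} then f |` set xs else (f |` set xs)(x \<mapsto> Min C))"
    by (simp only: fold_append fold.simps o_apply id_apply greedy_step_def Let_def)
  \<comment> \<open>No free candidate lies below the partner of \<open>x\<close>; without a partner none is free at all.\<close>
  have occupied: "\<exists>z. f x = Some z \<and> z \<le> y" if y: "y \<in> C" for y
  proof (rule ccontr)
    assume "\<not> ?thesis"
    then obtain x' where "x' \<in> L3_rank n i" "x' < x" "f x' = Some y"
      using taken[OF x(1), of y] y by (auto simp: C_def not_le)
    then have "y \<in> ran (f |` set xs)"
      using below by (intro ranI[of _ x']) simp
    then show False using y by (simp add: C_def)
  qed
  show ?case
  proof (cases "f x")
    case None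
    then have "C = {}" using occupied by fastforce
    then show ?thesis
      using step None x by (auto simp: restrict_map_def fun_eq_iff)
  next
    case (Some z)
    have "z \<notin> ran (f |` set xs)"
      using inj[OF Some] x(2) by (auto simp: ran_def restrict_map_def split: if_splits)
    then have z: "z \<in> C" using cand[OF x(1) Some] by (simp add: C_def)
    have "finite C"
      by (rule finite_subset[OF _ finite_L3_rank[of n "i + 1"]]) (auto simp: C_def candidates_def)
    then have "Min C = z"
      using z occupied Some by (intro Min_eqI) auto
    then show ?thesis
      using step z Some by (auto simp: restrict_map_def fun_eq_iff)
  qed
qed

lemma greedy_eqI:
  fixes f :: "triple \<Rightarrow> triple option"
  assumes "\<And>x y. x \<in> L3_rank n i \<Longrightarrow> f x = Some y \<Longrightarrow> y \<in> candidates n i x"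
    and "\<And>x x' y. f x = Some y \<Longrightarrow> f x' = Some y \<Longrightarrow> x = x'"
    and "\<And>x y. x \<in> L3_rank n i \<Longrightarrow> y \<in> candidates n i x \<Longrightarrow>
      (\<And>z. f x = Some z \<Longrightarrow> y < z) \<Longrightarrow> \<exists>x' \<in> L3_rank n i. x' < x \<and> f x' = Some y"
  shows "greedy n i = f |` L3_rank n i"
proof -
  have "fold (greedy_step n i) (sorted_list_of_set (L3_rank n i)) Map.empty =
      f |` set (sorted_list_of_set (L3_rank n i))"
  proof (rule fold_greedy_step_eq)
    show "sorted_wrt (<) (sorted_list_of_set (L3_rank n i))"
      by (rule strict_sorted_list_of_set)
  qed (use assms finite_L3_rank in auto)
  then show ?thesis
    by (simp add: greedy_def finite_L3_rank)
qed

section \<open>The cover relation\<close>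

lemma candidates_iff:
  assumes "(a, b, c) \<in> L3_rank n i"
  shows "y \<in> candidates n i (a, b, c) \<longleftrightarrow>
    y \<in> L3 n \<and> y \<in> {(a + 1, b, c), (a, b + 1, c), (a, b, c + 1)}"
proof -
  obtain p q r where y: "y = (p, q, r)" by (cases y)
  have "\<not> (comp_less (a, b, c) z \<and> comp_less z y)" if "p + q + r = a + b + c + 1" for z
    using that by (cases z) (auto simp: comp_less_def y)
  moreover have "comp_less (a, b, c) y \<longleftrightarrow>
      y \<in> {(a + 1, b, c), (a, b + 1, c), (a, b, c + 1)}" if "p + q + r = a + b + c + 1"
    using that by (auto simp: comp_less_def y)
  ultimately show ?thesis
    using assms by (auto simp: candidates_def covered_by_def L3_rank_def y)
qed

section \<open>The three rules of the map\<close>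

text \<open>
  \<open>2 * b - a - c\<close> is the slack. For triples in \<open>L3 n\<close> the first predicate is membership in
  \<open>E3 a\<close> (see \<open>mem_E3_iff\<close>). The predicates are defined on all integers, so that the
  rules can also be tested at predecessors that violate the order of the entries.
\<close>

definition raises_first :: "int \<Rightarrow> int \<Rightarrow> int \<Rightarrow> bool" where
  "raises_first a b c \<longleftrightarrow> even (a - b) \<and> 0 \<le> 2 * b - a - c \<and> 2 * b - a - c \<noteq> 1"

definition raises_second :: "int \<Rightarrow> int \<Rightarrow> int \<Rightarrow> bool" where
  "raises_second a b c \<longleftrightarrow>
    \<not> raises_first a b c \<and> (even (b + c) \<or> odd (a - b) \<and> 0 \<le> 2 * b - a - c)"

definition raises_third :: "int \<Rightarrow> int \<Rightarrow> int \<Rightarrow> bool" where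
  "raises_third a b c \<longleftrightarrow> \<not> raises_first a b c \<and> \<not> raises_second a b c"

text \<open>
  The dual of \<open>(4k + l, 2k, 0)\<close> in \<open>L3 n\<close> is \<open>(n, n - 2k, n - 4k - l)\<close>, with slack \<open>l\<close> and with
  entries differing by \<open>2k\<close> at the front. Both parameters can thus be recovered from the dual.
\<close>

lemma mem_E3_iff:
  "(a, b, c) \<in> E3 n \<longleftrightarrow> a = n \<and> b \<le> a \<and> 0 \<le> c \<and> raises_first a b c"
    (is "?L \<longleftrightarrow> ?R")
proof
  assume ?L
  then show ?R by (auto simp: E3_def S3_def raises_first_def)
next
  assume R: ?R
  then have "even (a - b)" unfolding raises_first_def by blast
  then obtain k where k: "a - b = 2 * k" by (rule evenE)
  define l where "l = 2 * b - a - c"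
  have "(4 * k + l, 2 * k, 0) \<in> S3 n"
    unfolding S3_def using R k l_def
    by (auto simp: raises_first_def intro!: exI[of _ k] exI[of _ l])
  then have "dual3 n (4 * k + l, 2 * k, 0) \<in> E3 n"
    unfolding E3_def by (rule imageI)
  moreover have "dual3 n (4 * k + l, 2 * k, 0) = (a, b, c)"
    using R k by (simp add: l_def)
  ultimately show ?L by (simp only:)
qed

text \<open>
  Let \<open>s\<close> be the slack of \<open>(a, b, c)\<close>. Suppose that \<open>b + c\<close> is even and that
  \<open>(a - 1, b + 1, c)\<close>, which has slack \<open>s + 3\<close>, lies in
  \<open>E3 (a - 1)\<close>. Then \<open>a - b\<close> is even, hence \<open>s\<close> is even, and \<open>s + 3 \<ge> 0\<close> with \<open>s + 3 \<noteq> 1\<close> forces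
  \<open>s \<ge> 0\<close>: the first rule applies already. This is why the rules cover all cases and why
  an even sum \<open>b + c\<close> always leads to the second rule when the first one fails. If \<open>b + c\<close> is odd,
  \<open>(a - 1, b, c + 1)\<close> has the same slack as \<open>(a, b, c)\<close>; for odd \<open>a - b\<close> it is even, so the
  value 1 does not occur.
\<close>

lemma phi_rule_eq:
  assumes "(a, b, c) \<in> L3 n"
  shows "phi_rule (a, b, c) = Some
    (if raises_first a b c then (a + 1, b, c)
     else if raises_second a b c then (a, b + 1, c)
     else (a, b, c + 1))"
proof -
  have ord: "b \<le> a" "c \<le> b" "0 \<le> c"
    using assms by (simp_all add: L3_def)
  have "(a - 1, b + 1, c) \<notin> E3 (a - 1)" if "\<not> raises_first a b c" "even (b + c)"
    using that unfolding mem_E3_iff raises_first_def by presburger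
  moreover have "(a - 1, b, c + 1) \<in> E3 (a - 1) \<longleftrightarrow> raises_second a b c"
    if "\<not> raises_first a b c" "odd (b + c)"
    using that ord unfolding mem_E3_iff raises_second_def raises_first_def by presburger
  moreover have "raises_second a b c" if "\<not> raises_first a b c" "even (b + c)"
    using that by (simp add: raises_second_def)
  moreover have "(a, b, c) \<in> E3 a \<longleftrightarrow> raises_first a b c"
    using ord by (simp add: mem_E3_iff)
  ultimately show ?thesis
    unfolding phi_rule.simps by (simp split: if_split) blast
qed

text \<open>
  The rules never break the order of the entries: a triple with \<open>a = b\<close> has slack \<open>b - c\<close>, which
  is nonnegative, so it obeys the first rule, or has slack 1 and obeys the third; a triple with
  \<open>b = c\<close> has even \<open>b + c\<close> and does not obey the third. Only raising
  the first entry can leave \<open>L3 n\<close>, and it does so exactly on \<open>E3 n\<close>.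
\<close>

lemma phi_eq_Some_iff:
  assumes "(a, b, c) \<in> L3 n"
  shows "phi n (a, b, c) = Some y \<longleftrightarrow> y \<in> L3 n \<and>
    (raises_first a b c \<and> y = (a + 1, b, c) \<or>
     raises_second a b c \<and> y = (a, b + 1, c) \<or>
     raises_third a b c \<and> y = (a, b, c + 1))"
proof -
  have ord: "a \<le> n" "b \<le> a" "c \<le> b" "0 \<le> c"
    using assms by (simp_all add: L3_def)
  have E: "(a, b, c) \<in> E3 n \<longleftrightarrow> a = n \<and> raises_first a b c"
    using ord by (simp add: mem_E3_iff)
  have second: "b < a" if "raises_second a b c"
  proof (rule ccontr)
    assume "\<not> b < a"
    then show False
      using that ord unfolding raises_second_def raises_first_def by presburger
  qed
  have third: "c < b" if "raises_third a b c"
  proof (rule ccontr)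
    assume "\<not> c < b"
    then show False
      using that ord unfolding raises_third_def raises_second_def by simp
  qed
  have phi: "phi n (a, b, c) = (if a = n \<and> raises_first a b c then None else Some
      (if raises_first a b c then (a + 1, b, c)
       else if raises_second a b c then (a, b + 1, c)
       else (a, b, c + 1)))"
    unfolding phi_def phi_rule_eq[OF assms] using assms E by simp
  consider "raises_first a b c" "\<not> raises_second a b c" "\<not> raises_third a b c"
    | "\<not> raises_first a b c" "raises_second a b c" "\<not> raises_third a b c"
    | "\<not> raises_first a b c" "\<not> raises_second a b c" "raises_third a b c"
    unfolding raises_third_def raises_second_def by blast
  then show ?thesis
  proof cases
    case 1
    then show ?thesis using ord by (auto simp: phi L3_def)
  next
    case 2
    then show ?thesis using ord second by (auto simp: phi L3_def)
  next
    case 3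
    then show ?thesis using ord third by (auto simp: phi L3_def)
  qed
qed

lemma phi_cover:
  assumes "(a, b, c) \<in> L3 n" and "phi n (a, b, c) = Some y"
  shows "y \<in> L3 n \<and> y \<in> {(a + 1, b, c), (a, b + 1, c), (a, b, c + 1)}"
  using assms by (auto simp: phi_eq_Some_iff)

text \<open>
  This is the injectivity of \<open>\<phi>\<close>: the three triples are the possible predecessors of
  \<open>(p, q, r)\<close>. All conditions become conditions on the slack \<open>s\<close> of \<open>(p, q, r)\<close> and the parities of
  \<open>p - q\<close> and \<open>q + r\<close>. The first rule needs \<open>p - q\<close> odd and \<open>s \<ge> -1\<close>; the second then
  needs \<open>q + r\<close> odd, whence \<open>s\<close> is even, and excludes the even values \<open>s \<ge> 2\<close>, while \<open>s = 0\<close>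
  fails the first rule. The third rule needs \<open>q + r\<close> even, and \<open>s < -1\<close> if \<open>p - q\<close> is odd
  and \<open>s < -1\<close> or \<open>s = 0\<close> otherwise; for even \<open>q + r\<close> the second needs \<open>p - q\<close> even and \<open>s \<ge> 2\<close>.
\<close>

lemma rules_exclusive:
  shows "raises_first (p - 1) q r \<Longrightarrow> \<not> raises_second p (q - 1) r"
    and "raises_first (p - 1) q r \<Longrightarrow> \<not> raises_third p q (r - 1)"
    and "raises_second p (q - 1) r \<Longrightarrow> \<not> raises_third p q (r - 1)"
proof -
  define s where "s = 2 * q - p - r"
  have parity: "even s \<longleftrightarrow> (even (p - q) \<longleftrightarrow> even (q + r))"
    by (auto simp: s_def)
  have slack: "2 * q - (p - 1) - r = s + 1" "2 * (q - 1) - p - r = s - 2"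
      "2 * q - p - (r - 1) = s + 1"
    by (simp_all add: s_def)
  have first: "raises_first (p - 1) q r \<longleftrightarrow> odd (p - q) \<and> 0 \<le> s + 1 \<and> s + 1 \<noteq> 1"
    unfolding raises_first_def slack by auto
  have second: "raises_second p (q - 1) r \<longleftrightarrow>
      \<not> (odd (p - q) \<and> 0 \<le> s - 2 \<and> s - 2 \<noteq> 1) \<and> (odd (q + r) \<or> even (p - q) \<and> 0 \<le> s - 2)"
    unfolding raises_second_def raises_first_def slack by auto
  have third: "raises_third p q (r - 1) \<longleftrightarrow>
      \<not> (even (p - q) \<and> 0 \<le> s + 1 \<and> s + 1 \<noteq> 1) \<and> even (q + r) \<and> \<not> (odd (p - q) \<and> 0 \<le> s + 1)"
    unfolding raises_third_def raises_second_def raises_first_def slack by auto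
  show "raises_first (p - 1) q r \<Longrightarrow> \<not> raises_second p (q - 1) r"
    using parity unfolding first second by (cases "s = 0 \<or> s = 1 \<or> s = 3") auto
  show "raises_first (p - 1) q r \<Longrightarrow> \<not> raises_third p q (r - 1)"
    unfolding first third by blast
  show "raises_second p (q - 1) r \<Longrightarrow> \<not> raises_third p q (r - 1)"
    unfolding second third by auto
qed

lemma phi_dom: "phi n x = Some y \<Longrightarrow> x \<in> L3 n"
  by (auto simp: phi_def split: if_splits)

lemma phi_inj:
  assumes "phi n x = Some y" and "phi n x' = Some y"
  shows "x = x'"
proof -
  obtain a b c where x: "x = (a, b, c)" by (cases x)
  obtain a' b' c' where x': "x' = (a', b', c')" by (cases x')
  obtain p q r where y: "y = (p, q, r)" by (cases y)
  have "raises_first (p - 1) q r \<and> x = (p - 1, q, r) \<or>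
      raises_second p (q - 1) r \<and> x = (p, q - 1, r) \<or>
      raises_third p q (r - 1) \<and> x = (p, q, r - 1)"
    using assms(1) phi_dom[OF assms(1)] unfolding x y by (auto simp: phi_eq_Some_iff)
  moreover have "raises_first (p - 1) q r \<and> x' = (p - 1, q, r) \<or>
      raises_second p (q - 1) r \<and> x' = (p, q - 1, r) \<or>
      raises_third p q (r - 1) \<and> x' = (p, q, r - 1)"
    using assms(2) phi_dom[OF assms(2)] unfolding x' y by (auto simp: phi_eq_Some_iff)
  ultimately show ?thesis
    using rules_exclusive[of p q r] by auto
qed

section \<open>Smaller covers are already taken\<close>

text \<open>
  If \<open>(a, b, c)\<close> obeys the first rule, so does \<open>(a - 1, b + 1, c)\<close>: the parity of the first
  difference is the same and the slack grows by 3.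
\<close>

lemma second_cover_taken:
  assumes "(a, b, c) \<in> L3 n" "(a, b + 1, c) \<in> L3 n" "raises_first a b c"
  shows "(a - 1, b + 1, c) \<in> L3 n \<and> raises_first (a - 1) (b + 1) c"
proof -
  have "even (a - b)" using assms(3) by (simp only: raises_first_def)
  then have "a \<noteq> b + 1" by auto
  then show ?thesis
    using assms by (auto simp: L3_def raises_first_def)
qed

text \<open>
  A triple below \<open>(a, b, c + 1)\<close> other than \<open>(a, b, c)\<close> claims it. The candidate
  \<open>(a - 1, b, c + 1)\<close> has the same slack as \<open>(a, b, c)\<close>, but the parity of the first difference is
  reversed. If the first rule fails there, then the second applies to \<open>(a, b - 1, c + 1)\<close>,
  whose slack is \<open>s - 3\<close>: either \<open>b + c\<close> is even, or \<open>(a, b, c)\<close> obeys the first rule with odd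
  slack, so that \<open>s \<ge> 3\<close>.
\<close>

lemma third_cover_taken:
  assumes "(a, b, c) \<in> L3 n" "(a, b, c + 1) \<in> L3 n" "\<not> raises_third a b c"
  shows "(a - 1, b, c + 1) \<in> L3 n \<and> raises_first (a - 1) b (c + 1) \<or>
    (a, b - 1, c + 1) \<in> L3 n \<and> raises_second a (b - 1) (c + 1)"
proof -
  have ord: "a \<le> n" "b \<le> a" "c < b" "0 \<le> c"
    using assms(1,2) by (simp_all add: L3_def)
  define s where "s = 2 * b - a - c"
  have parity: "even s \<longleftrightarrow> (even (a - b) \<longleftrightarrow> even (b + c))"
    by (auto simp: s_def)
  have slack: "2 * b - (a - 1) - (c + 1) = s" "2 * (b - 1) - a - (c + 1) = s - 3"
    by (simp_all add: s_def)
  have first: "raises_first (a - 1) b (c + 1) \<longleftrightarrow> odd (a - b) \<and> 0 \<le> s \<and> s \<noteq> 1"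
    unfolding raises_first_def slack by auto
  have second: "raises_second a (b - 1) (c + 1) \<longleftrightarrow>
      \<not> (odd (a - b) \<and> 0 \<le> s - 3 \<and> s - 3 \<noteq> 1) \<and> (even (b + c) \<or> even (a - b) \<and> 0 \<le> s - 3)"
    unfolding raises_second_def raises_first_def slack by auto
  have x: "even (a - b) \<and> 0 \<le> s \<and> s \<noteq> 1 \<or> even (b + c) \<or> odd (a - b) \<and> 0 \<le> s"
    using assms(3) unfolding raises_third_def raises_second_def raises_first_def s_def by blast
  show ?thesis
  proof (cases "odd (a - b) \<and> 0 \<le> s \<and> s \<noteq> 1")
    case True
    then have "b \<noteq> a" by auto
    then show ?thesis using True ord unfolding first by (simp add: L3_def)
  next
    case False
    have *: "even (b + c) \<or> even (a - b) \<and> 0 \<le> s - 3"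
    proof (cases "even (b + c)")
      case odd: False
      then have "even (a - b)" "0 \<le> s" "s \<noteq> 1" "odd s"
        using x False parity by auto
      then have "s \<noteq> 0" "s \<noteq> 2" by auto
      with \<open>0 \<le> s\<close> \<open>s \<noteq> 1\<close> have "0 \<le> s - 3" by linarith
      with \<open>even (a - b)\<close> show ?thesis by simp
    qed simp
    then have "raises_second a (b - 1) (c + 1)"
      using False unfolding second by auto
    \<comment> \<open>For \<open>b = c + 1\<close> the sum \<open>b + c\<close> is odd and the slack is \<open>b + 1 - a\<close>, at most 1.\<close>
    moreover have "b \<noteq> c + 1"
      using * ord by (auto simp: s_def)
    ultimately show ?thesis using ord by (simp add: L3_def)
  qed
qed

lemma smaller_cover_taken:
  assumes x: "(a, b, c) \<in> L3 n"
    and y: "y \<in> L3 n" "y \<in> {(a + 1, b, c), (a, b + 1, c), (a, b, c + 1)}"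
    and smaller: "\<And>z. phi n (a, b, c) = Some z \<Longrightarrow> y < z"
  shows "\<exists>x' < (a, b, c). phi n x' = Some y"
proof -
  \<comment> \<open>The covers smaller than \<open>\<phi> (a, b, c)\<close> raise an entry to the right of the one that the
    rule raises. On \<open>E3 n\<close> the first rule would leave \<open>L3 n\<close>, and the same description holds.\<close>
  have
    "y = (a, b + 1, c) \<and> raises_first a b c \<or> y = (a, b, c + 1) \<and> \<not> raises_third a b c"
  proof (cases "raises_first a b c")
    case True
    then have "y \<noteq> (a + 1, b, c)"
      using smaller[of y] x y(1) by (auto simp: phi_eq_Some_iff)
    then show ?thesis using True y(2) by (auto simp: raises_third_def)
  next
    case False
    then obtain z where z: "phi n (a, b, c) = Some z"
      using x by (auto simp: phi_def mem_E3_iff phi_rule_eq simp del: phi_rule.simps)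
    have "y < z" using smaller z .
    then show ?thesis
      using z False x y(2) by (auto simp: phi_eq_Some_iff raises_third_def)
  qed
  then show ?thesis
  proof (elim disjE conjE)
    assume *: "y = (a, b + 1, c)" "raises_first a b c"
    then have "phi n (a - 1, b + 1, c) = Some y"
      using second_cover_taken[of a b c n] x y(1) by (simp add: phi_eq_Some_iff)
    then show ?thesis by (intro exI[of _ "(a - 1, b + 1, c)"]) simp
  next
    assume *: "y = (a, b, c + 1)" "\<not> raises_third a b c"
    then have "phi n (a - 1, b, c + 1) = Some y \<or> phi n (a, b - 1, c + 1) = Some y"
      using third_cover_taken[of a b c n] x y(1) by (auto simp: phi_eq_Some_iff)
    moreover have "(a - 1, b, c + 1) < (a, b, c)" "(a, b - 1, c + 1) < (a, b, c)"
      by simp_all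
    ultimately show ?thesis by blast
  qed
qed

lemma rank3_phi: "phi n x = Some y \<Longrightarrow> rank3 y = rank3 x + 1"
  using phi_dom[of n x y] by (cases x) (auto simp: phi_eq_Some_iff)

lemma greedy_eq_phi: "greedy n i = phi n |` L3_rank n i"
proof (rule greedy_eqI)
  show "y \<in> candidates n i x" if "x \<in> L3_rank n i" "phi n x = Some y" for x y
    using that phi_cover[of _ _ _ n y] phi_dom[OF that(2)]
    by (cases x) (metis candidates_iff)
  show "x = x'" if "phi n x = Some y" "phi n x' = Some y" for x x' y
    using that by (rule phi_inj)
  show "\<exists>x' \<in> L3_rank n i. x' < x \<and> phi n x' = Some y"
    if "x \<in> L3_rank n i" "y \<in> candidates n i x" and smaller: "\<And>z. phi n x = Some z \<Longrightarrow> y < z" for x y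
  proof -
    obtain a b c where x: "x = (a, b, c)" by (cases x)
    have "(a, b, c) \<in> L3 n" using that(1) by (simp add: x L3_rank_def)
    moreover have "y \<in> L3 n" "y \<in> {(a + 1, b, c), (a, b + 1, c), (a, b, c + 1)}"
      using that(1,2) by (simp_all add: x candidates_iff)
    ultimately obtain x' where x': "x' < x" "phi n x' = Some y"
      using smaller_cover_taken smaller unfolding x by blast
    have "rank3 y = i + 1" using that(2) by (simp add: candidates_def L3_rank_def)
    then have "x' \<in> L3_rank n i"
      using rank3_phi[OF x'(2)] phi_dom[OF x'(2)] by (simp add: L3_rank_def)
    with x' show ?thesis by blast
  qed
qed

theorem proposition9:
  fixes n :: int
  assumes "n \<ge> 1"
  shows "(\<forall>x \<in> L3 n. GA n x \<noteq> None \<longleftrightarrow> x \<notin> E3 n) \<and>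
         (\<forall>x \<in> L3 n. x \<notin> E3 n \<longrightarrow> phi n x = GA n x)"
proof -
  have "GA n x = phi n x" if "x \<in> L3 n" for x
    using that by (simp add: GA_def greedy_eq_phi L3_rank_def)
  moreover have "phi n x \<noteq> None \<longleftrightarrow> x \<notin> E3 n" if "x \<in> L3 n" for x
    using that by (cases x) (simp add: phi_def phi_rule_eq del: phi_rule.simps)
  ultimately show ?thesis by simp
qed

end
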